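(* Let $a>0$, $b=0$, $\gamma>0$ and let $L\ge1$ be an integer. Consider the model $y\mid\theta\sim N(\theta,1)$, $\theta\mid u\sim N(0,u)$, with $u>0$ having probability density proportional to $$\frac{u^{a-1}}{(1+u)^{a+b}}\left\{\prod_{k=1}^{L-1}\frac1{f_k(1+u)}\right\}\frac1{f_L(1+u)^{1+\gamma}}$$ (the iteratively log-adjusted shrinkage prior). Then the posterior mean squared error $\mathrm{MSE}(\theta\mid y)=E[(\theta-y)^2\mid y]$ satisfies, as $|y|\to\infty$, $$\mathrm{MSE}(\theta\mid y)=1+\frac{1}{y^2/2}\left\{1-\frac{3a/2}{y^2/2}+\sum_{k=1}^{L-1}\prod_{j=1}^{k}\frac{1}{f_j(1+y^2/2)}+(1+\gamma)\prod_{j=1}^{L}\frac1{f_j(1+y^2/2)}\right\}+o\!\left(\frac1{y^2}\right),$$ where $y^2\,o(1/y^2)\to0$ as $|y|\to\infty$.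
   Context: For $z\ge1$ define $f_1(z)=f(z)=1+\log z$ and inductively $f_{L+1}(z)=f(f_L(z))=1+\log f_L(z)$ for $L=1,2,\dots$. Empty products equal $1$ and empty sums equal $0$. $N(\mu,\sigma^2)$ denotes the normal distribution with mean $\mu$ and variance $\sigma^2$. The expectation $E[\,\cdot\mid y]$ is under the posterior distribution of $\theta$ given the scalar observation $y$. *)

theory Defs
  imports "HOL-Probability.Probability" "HOL-Library.Landau_Symbols"
begin

(* iter_log L is f_L, the L-fold iterate of f z = 1 + ln z. *)
definition iter_log :: "nat \<Rightarrow> real \<Rightarrow> real" where
  "iter_log L = ((\<lambda>z. 1 + ln z) ^^ L)"

(* The probability measure whose density with respect to M is proportional to g. *)
definition normalized_density :: "'a measure \<Rightarrow> ('a \<Rightarrow> real) \<Rightarrow> 'a measure" where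
  "normalized_density M g =
     density M (\<lambda>x. ennreal (g x) / (\<integral>\<^sup>+ t. ennreal (g t) \<partial>M))"

definition shrinkage_weight :: "real \<Rightarrow> real \<Rightarrow> real \<Rightarrow> nat \<Rightarrow> real \<Rightarrow> real" where
  "shrinkage_weight a b \<gamma> L u =
     indicator {0<..} u *
     (u powr (a - 1) / (1 + u) powr (a + b) *
      (\<Prod>k\<in>{1..<L}. 1 / iter_log k (1 + u)) *
      (1 / iter_log L (1 + u) powr (1 + \<gamma>)))"

definition prior_u :: "real \<Rightarrow> real \<Rightarrow> real \<Rightarrow> nat \<Rightarrow> real measure" where
  "prior_u a b \<gamma> L = normalized_density lborel (shrinkage_weight a b \<gamma> L)"

(* The marginal law of theta: draw u from prior_u, then theta from N(0, u).
   normal_density is parametrised by the standard deviation, hence sqrt u. *)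
definition prior_theta :: "real \<Rightarrow> real \<Rightarrow> real \<Rightarrow> nat \<Rightarrow> real measure" where
  "prior_theta a b \<gamma> L =
     prior_u a b \<gamma> L \<bind> (\<lambda>u. density lborel (\<lambda>\<theta>. ennreal (normal_density 0 (sqrt u) \<theta>)))"

(* Bayes' rule for y | theta ~ N(theta, 1). This fixes the canonical version of the
   conditional law, defined for every y and not only for almost every y. *)
definition posterior :: "real \<Rightarrow> real \<Rightarrow> real \<Rightarrow> nat \<Rightarrow> real \<Rightarrow> real measure" where
  "posterior a b \<gamma> L y =
     normalized_density (prior_theta a b \<gamma> L) (\<lambda>\<theta>. normal_density \<theta> 1 y)"

definition MSE :: "real \<Rightarrow> real \<Rightarrow> real \<Rightarrow> nat \<Rightarrow> real \<Rightarrow> real" where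
  "MSE a b \<gamma> L y = (\<integral>\<theta>. (\<theta> - y)\<^sup>2 \<partial>posterior a b \<gamma> L y)"

end

theory Submission
  imports Defs "HOL-Real_Asymp.Real_Asymp"
begin

text \<open>Every correction term in the braces tends to 0, so the expansion up to \<open>o(1 / y\<^sup>2)\<close> amounts to
  \<open>s (MSE - 1) \<longrightarrow> 1\<close> for \<open>s = y\<^sup>2 / 2\<close>. Given \<open>u\<close>, the posterior of \<open>\<theta>\<close> is normal with mean
  \<open>u y / (1 + u)\<close> and variance \<open>u / (1 + u)\<close>, so \<open>MSE = 1 - I(3/2) / I(1/2) + 2 s I(5/2) / I(1/2)\<close>, where
  \<open>I(q)\<close> integrates \<open>(1 + u) powr - q * exp (- s / (1 + u))\<close> against the unnormalised prior of \<open>u\<close>. Because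
  the log factor of the prior is slowly varying, \<open>s powr q * I(q)\<close> divided by the log factor at \<open>s\<close>
  converges to \<open>M(q) = \<integral> v powr (- q - 1) * exp (- 1 / v)\<close> over \<open>v > 0\<close>. Since \<open>M(q + 1) = q M(q)\<close>, the
  limit of \<open>s (MSE - 1)\<close> is \<open>- 1/2 + 2 * 3/2 * 1/2 = 1\<close>.\<close>

section \<open>Iterated logarithms\<close>

lemma iter_log_0 [simp]: "iter_log 0 z = z"
  by (simp add: iter_log_def)

lemma iter_log_Suc [simp]: "iter_log (Suc k) z = 1 + ln (iter_log k z)"
  by (simp add: iter_log_def)

lemma iter_log_1 [simp]: "iter_log k 1 = 1"
  by (induction k) auto

lemma iter_log_ge_1: "1 \<le> z \<Longrightarrow> 1 \<le> iter_log k z"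
  by (induction k) auto

lemma iter_log_pos: "1 \<le> z \<Longrightarrow> 0 < iter_log k z"
  using iter_log_ge_1 [of z k] by linarith

lemma iter_log_mono: "1 \<le> x \<Longrightarrow> x \<le> y \<Longrightarrow> iter_log k x \<le> iter_log k y"
proof (induction k)
  case (Suc k)
  then show ?case using iter_log_pos [of x k] by (simp add: ln_mono)
qed simp

lemma iter_log_le: "1 \<le> z \<Longrightarrow> iter_log k z \<le> z"
proof (induction k)
  case (Suc k)
  then show ?case using ln_le_minus_one [OF iter_log_pos [of z k]] by simp
qed simp

text \<open>Induction: the logarithm turns the bound into a sum, and
  \<open>1 + p + q \<le> (1 + p) * (1 + q)\<close> for the nonnegative logarithms \<open>p\<close>
  and \<open>q\<close>. This submultiplicativity is the source of the polynomial bounds on the log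
  factor.\<close>

lemma iter_log_mult_le:
  assumes "1 \<le> x" "1 \<le> y"
  shows "iter_log k (x * y) \<le> iter_log k x * iter_log k y"
proof (induction k)
  case (Suc k)
  let ?u = "iter_log k x" and ?v = "iter_log k y"
  have u: "1 \<le> ?u" and v: "1 \<le> ?v"
    using assms iter_log_ge_1 by blast+
  have "1 \<le> x * y" using assms by (simp add: mult_ge1_I)
  then have "ln (iter_log k (x * y)) \<le> ln (?u * ?v)"
    using Suc iter_log_pos [of "x * y" k] by (intro ln_mono) auto
  also have "\<dots> = ln ?u + ln ?v"
    using u v by (simp add: ln_mult)
  also have "1 + \<dots> \<le> (1 + ln ?u) * (1 + ln ?v)"
    using u v by (simp add: algebra_simps)
  finally show ?case by simp
qed simp

lemma iter_log_at_top: "filterlim (iter_log k) at_top at_top"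
proof (induction k)
  case (Suc k)
  have "filterlim (\<lambda>z. 1 + ln (iter_log k z)) at_top at_top"
    by (intro filterlim_tendsto_add_at_top [OF tendsto_const] filterlim_compose [OF ln_at_top Suc])
  then show ?case by simp
qed (simp add: filterlim_ident)

text \<open>Slow variation. The statement starts at \<open>Suc k\<close> because the ratio at index
  0 is \<open>v\<close> itself; a single logarithm already turns any positive limit of the ratio
  into 1.\<close>

lemma iter_log_ratio_tendsto:
  assumes v: "0 < v"
  shows "((\<lambda>s. iter_log (Suc k) (s * v) / iter_log (Suc k) s) \<longlongrightarrow> 1) at_top"
proof -
  have sv: "filterlim (\<lambda>s. s * v) at_top at_top"
    using v by real_asymp
  have pos: "\<forall>\<^sub>F s in at_top. 0 < iter_log k (s * v) \<and> 0 < iter_log k s" for k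
    using filterlim_at_top_dense [THEN iffD1, OF iter_log_at_top [of k], rule_format, of 0]
      filterlim_at_top_dense [THEN iffD1, OF filterlim_compose [OF iter_log_at_top [of k] sv], rule_format, of 0]
    by eventually_elim simp
  \<comment> \<open>The limit \<open>c\<close> is left arbitrary so that one argument serves the
    base case, with \<open>c = v\<close>, and all later ones, with \<open>c = 1\<close>. The
    logarithm of the ratio stays bounded while the denominator \<open>iter_log (Suc k) s\<close>
    diverges.\<close>
  have step: "((\<lambda>s. iter_log (Suc k) (s * v) / iter_log (Suc k) s) \<longlongrightarrow> 1) at_top"
    if c: "0 < c" and lim: "((\<lambda>s. iter_log k (s * v) / iter_log k s) \<longlongrightarrow> c) at_top" for k c
  proof -
    have "((\<lambda>s. 1 + ln (iter_log k (s * v) / iter_log k s) / iter_log (Suc k) s) \<longlongrightarrow> 1 + 0) at_top"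
      using c by (intro tendsto_intros tendsto_divide_0 [OF tendsto_ln [OF lim]]
          filterlim_at_top_imp_at_infinity iter_log_at_top) auto
    moreover have "\<forall>\<^sub>F s in at_top. 1 + ln (iter_log k (s * v) / iter_log k s) / iter_log (Suc k) s
        = iter_log (Suc k) (s * v) / iter_log (Suc k) s"
      using pos [of k] pos [of "Suc k"]
      by eventually_elim (simp add: ln_div divide_simps)
    ultimately show ?thesis
      using Lim_transform_eventually by fastforce
  qed
  show ?thesis
  proof (induction k)
    case 0
    have "\<forall>\<^sub>F s in at_top. v = iter_log 0 (s * v) / iter_log 0 s"
      using eventually_gt_at_top [of 0] by eventually_elim simp
    then have "((\<lambda>s. iter_log 0 (s * v) / iter_log 0 s) \<longlongrightarrow> v) at_top"
      by (rule Lim_transform_eventually [OF tendsto_const])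
    then show ?case by (rule step [OF v])
  next
    case (Suc k)
    show ?case by (rule step [OF zero_less_one Suc])
  qed
qed

text \<open>Chain rule: each further logarithm contributes the reciprocal of the previous iterate.
  This provides an explicit antiderivative for the tail of the prior.\<close>

lemma iter_log_deriv:
  assumes "1 \<le> z"
  shows "(iter_log k has_real_derivative (\<Prod>j<k. 1 / iter_log j z)) (at z)"
proof (induction k)
  case 0
  have "iter_log 0 = (\<lambda>z. z)" by auto
  then show ?case by simp
next
  case (Suc k)
  have "((\<lambda>z. 1 + ln (iter_log k z)) has_real_derivative (\<Prod>j<Suc k. 1 / iter_log j z)) (at z)"
    using iter_log_pos [OF assms, of k]
    by (auto intro!: derivative_eq_intros Suc.IH simp: mult.commute)
  then show ?case
    by simp
qed

lemma measurable_iter_log [measurable]: "iter_log k \<in> borel_measurable borel"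
proof (induction k)
  case 0
  have "iter_log 0 = (\<lambda>z. z)" by auto
  then show ?case by simp
next
  case (Suc k)
  then have [measurable]: "iter_log k \<in> borel_measurable borel" .
  have "(\<lambda>z. 1 + ln (iter_log k z)) \<in> borel_measurable borel" by measurable
  then show ?case by simp
qed

section \<open>The slowly varying log factor of the prior\<close>

text \<open>Written in the variable \<open>z = 1 + u\<close>, which is the one rescaled in the
  asymptotic analysis.\<close>

definition log_factor :: "real \<Rightarrow> nat \<Rightarrow> real \<Rightarrow> real" where
  "log_factor \<gamma> L z = (\<Prod>k\<in>{1..<L}. 1 / iter_log k z) * (1 / iter_log L z powr (1 + \<gamma>))"

lemma measurable_log_factor [measurable]: "log_factor \<gamma> L \<in> borel_measurable borel"
  unfolding log_factor_def by measurable

lemma log_factor_pos: "1 \<le> z \<Longrightarrow> 0 < log_factor \<gamma> L z"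
  using iter_log_pos [of z] unfolding log_factor_def
  by (intro mult_pos_pos prod_pos) (auto simp: less_imp_neq [symmetric])

lemma log_factor_antimono:
  assumes "1 \<le> x" "x \<le> y" "0 \<le> \<gamma>"
  shows "log_factor \<gamma> L y \<le> log_factor \<gamma> L x"
proof -
  have "1 \<le> y" using assms by simp
  show ?thesis
    unfolding log_factor_def
    using iter_log_mono [OF assms(1,2)] iter_log_pos [OF assms(1)] iter_log_pos [OF \<open>1 \<le> y\<close>] assms(3)
    by (intro mult_mono prod_mono prod_nonneg conjI frac_le powr_mono2)
       (auto simp: less_imp_le less_imp_neq [symmetric])
qed

lemma log_factor_le_1: "1 \<le> z \<Longrightarrow> 0 \<le> \<gamma> \<Longrightarrow> log_factor \<gamma> L z \<le> 1"
proof -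
  assume z: "1 \<le> z" "0 \<le> \<gamma>"
  have "log_factor \<gamma> L z \<le> log_factor \<gamma> L 1"
    using z by (intro log_factor_antimono) auto
  also have "log_factor \<gamma> L 1 = 1"
    by (simp add: log_factor_def)
  finally show ?thesis .
qed

text \<open>Submultiplicativity together with \<open>iter_log k y \<le> y\<close> costs at most one
  factor \<open>y\<close> per iterated logarithm. The resulting power is crude, but the inverse
  gamma kernel absorbs any power of \<open>v\<close> near 0.\<close>

lemma log_factor_mult_ge:
  assumes "1 \<le> x" "1 \<le> y" "0 \<le> \<gamma>" "1 \<le> L"
  shows "log_factor \<gamma> L x * y powr - (real L + \<gamma>) \<le> log_factor \<gamma> L (x * y)"
proof -
  have xy: "1 \<le> x * y" using assms by (simp add: mult_ge1_I)
  have le: "iter_log k (x * y) \<le> iter_log k x * y" for k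
    using iter_log_mult_le [OF assms(1,2), of k] iter_log_le [OF assms(2), of k]
      iter_log_pos [OF assms(1), of k]
    by (meson mult_left_mono order.trans less_imp_le)
  have inv: "1 / iter_log k x * (1 / y) \<le> 1 / iter_log k (x * y)" for k
    using le [of k] iter_log_pos [OF xy, of k] iter_log_pos [OF assms(1), of k] assms
    by (simp add: divide_simps)
  have "(\<Prod>k\<in>{1..<L}. 1 / iter_log k x) * (1 / y) ^ (L - 1)
      = (\<Prod>k\<in>{1..<L}. 1 / iter_log k x * (1 / y))"
    by (simp only: prod.distrib prod_constant card_atLeastLessThan)
  also have "\<dots> \<le> (\<Prod>k\<in>{1..<L}. 1 / iter_log k (x * y))"
    using inv iter_log_pos [OF assms(1)] assms by (intro prod_mono) (auto simp: less_imp_le)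
  finally have 1: "(\<Prod>k\<in>{1..<L}. 1 / iter_log k x) * (1 / y) ^ (L - 1)
      \<le> (\<Prod>k\<in>{1..<L}. 1 / iter_log k (x * y))" .
  have "1 / iter_log L x powr (1 + \<gamma>) * (1 / y powr (1 + \<gamma>)) = 1 / (iter_log L x * y) powr (1 + \<gamma>)"
    using iter_log_pos [OF assms(1), of L] assms by (simp add: powr_mult)
  also have "\<dots> \<le> 1 / iter_log L (x * y) powr (1 + \<gamma>)"
    using le iter_log_pos [OF xy, of L] iter_log_pos [OF assms(1), of L] assms
    by (intro divide_left_mono powr_mono2) (auto simp: less_imp_le less_imp_neq [symmetric])
  finally have 2: "1 / iter_log L x powr (1 + \<gamma>) * (1 / y powr (1 + \<gamma>)) \<le> 1 / iter_log L (x * y) powr (1 + \<gamma>)" .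
  \<comment> \<open>The exponent splits as \<open>(L - 1) + (1 + \<gamma>)\<close>: one unit for
    each of the \<open>L - 1\<close> plain factors and \<open>1 + \<gamma>\<close> for the last. The
    subtraction on naturals is exact because \<open>1 \<le> L\<close>.\<close>
  have "y powr - (real L + \<gamma>) = y powr (- (real (L - 1))) * y powr - (1 + \<gamma>)"
    using assms by (simp add: powr_add [symmetric] of_nat_diff)
  also have "\<dots> = (1 / y) ^ (L - 1) * (1 / y powr (1 + \<gamma>))"
    using assms powr_realpow [of y "L - 1"] by (simp only: powr_minus_divide) (simp add: power_one_over)
  finally have 3: "y powr - (real L + \<gamma>) = (1 / y) ^ (L - 1) * (1 / y powr (1 + \<gamma>))" .
  have "log_factor \<gamma> L x * y powr - (real L + \<gamma>)
      = ((\<Prod>k\<in>{1..<L}. 1 / iter_log k x) * (1 / y) ^ (L - 1))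
        * (1 / iter_log L x powr (1 + \<gamma>) * (1 / y powr (1 + \<gamma>)))"
    unfolding log_factor_def 3 by simp
  also have "\<dots> \<le> log_factor \<gamma> L (x * y)"
    unfolding log_factor_def using 1 2 iter_log_pos [OF assms(1)] iter_log_pos [OF xy] assms
    by (intro mult_mono) (auto intro!: prod_nonneg simp: less_imp_le)
  finally show ?thesis .
qed

text \<open>A Potter-type bound, uniform in \<open>s\<close>. For \<open>v \<ge> 1\<close>
  monotonicity bounds the ratio by 1; for \<open>v < 1\<close> the previous lemma is applied to
  \<open>s * v\<close> and \<open>1 / v\<close>, whose product is \<open>s\<close>. The sum of the
  two bounds covers both cases.\<close>

lemma log_factor_ratio_le:
  assumes "1 \<le> s" "1 \<le> s * v" "0 < v" "0 \<le> \<gamma>" "1 \<le> L"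
  shows "log_factor \<gamma> L (s * v) / log_factor \<gamma> L s \<le> 1 + v powr - (real L + \<gamma>)"
proof (cases "1 \<le> v")
  case True
  then have "log_factor \<gamma> L (s * v) \<le> log_factor \<gamma> L s"
    using assms by (intro log_factor_antimono) auto
  then have "log_factor \<gamma> L (s * v) / log_factor \<gamma> L s \<le> 1"
    using log_factor_pos [OF assms(1), of \<gamma> L] by simp
  then show ?thesis
    by (smt (verit) powr_ge_zero)
next
  case False
  have powr_one_divide: "(1 / v) powr - p = v powr p" for p
    using assms by (simp add: powr_minus powr_divide)
  have cancel: "s * v * (1 / v) = s" using assms by simp
  have "1 \<le> 1 / v" using False assms by simp
  from log_factor_mult_ge [OF assms(2) this assms(4,5)]
  have "log_factor \<gamma> L (s * v) * v powr (real L + \<gamma>) \<le> log_factor \<gamma> L s"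
    by (simp only: powr_one_divide cancel)
  then have "log_factor \<gamma> L (s * v) / log_factor \<gamma> L s \<le> v powr - (real L + \<gamma>)"
    using log_factor_pos [OF assms(1), of \<gamma> L] assms
    unfolding powr_minus [of v "real L + \<gamma>"] by (simp add: divide_simps)
  then show ?thesis by simp
qed

text \<open>All iterates involved have index at least 1, the last one because
  \<open>1 \<le> L\<close>, so each ratio of iterated logarithms tends to 1.\<close>

lemma log_factor_ratio_tendsto:
  assumes "0 < v" "1 \<le> L"
  shows "((\<lambda>s. log_factor \<gamma> L (s * v) / log_factor \<gamma> L s) \<longlongrightarrow> 1) at_top"
proof -
  have r: "((\<lambda>s. iter_log k (s * v) / iter_log k s) \<longlongrightarrow> 1) at_top" if "1 \<le> k" for k
    using iter_log_ratio_tendsto [OF assms(1), of "k - 1"] that by (cases k) auto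
  have "((\<lambda>s. (\<Prod>k\<in>{1..<L}. 1 / (iter_log k (s * v) / iter_log k s)) *
      (1 / (iter_log L (s * v) / iter_log L s) powr (1 + \<gamma>)))
      \<longlongrightarrow> (\<Prod>k\<in>{1..<L}. 1 / 1) * (1 / 1 powr (1 + \<gamma>))) at_top"
    using assms by (intro tendsto_mult tendsto_prod tendsto_divide tendsto_powr r tendsto_const) auto
  moreover have "\<forall>\<^sub>F s in at_top. (\<Prod>k\<in>{1..<L}. 1 / (iter_log k (s * v) / iter_log k s)) *
      (1 / (iter_log L (s * v) / iter_log L s) powr (1 + \<gamma>))
      = log_factor \<gamma> L (s * v) / log_factor \<gamma> L s"
    using eventually_ge_at_top [of "max 1 (1 / v)"]
  proof eventually_elim
    case (elim s)
    then have "1 \<le> s" "1 \<le> s * v" using assms by (auto simp: divide_simps)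
    then have p: "0 < iter_log k s" "0 < iter_log k (s * v)" for k
      by (auto intro: iter_log_pos)
    then show ?case
      using p [of L] by (simp add: log_factor_def powr_divide prod_dividef)
  qed
  ultimately show ?thesis
    using Lim_transform_eventually by fastforce
qed

section \<open>The inverse gamma kernel\<close>

text \<open>The unnormalised inverse gamma density of shape \<open>q\<close> and scale 1; for
  \<open>q > 0\<close> its total mass is Gamma(q).\<close>

definition inv_gamma_kernel :: "real \<Rightarrow> real \<Rightarrow> real" where
  "inv_gamma_kernel q v = indicator {0<..} v * (v powr (- q - 1) * exp (- 1 / v))"

lemma measurable_inv_gamma_kernel [measurable]: "inv_gamma_kernel q \<in> borel_measurable borel"
  unfolding inv_gamma_kernel_def by measurable

lemma inv_gamma_kernel_nonneg: "0 \<le> inv_gamma_kernel q v"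
  by (simp add: inv_gamma_kernel_def indicator_def)

lemma inv_gamma_kernel_pos: "0 < v \<Longrightarrow> 0 < inv_gamma_kernel q v"
  by (simp add: inv_gamma_kernel_def indicator_def)

text \<open>The left side is largest at \<open>x = p\<close>, where it equals
  \<open>p powr p * exp (- p)\<close>; the factor \<open>exp (- p)\<close> is dropped. The maximum
  is encoded by \<open>ln t \<le> t - 1\<close> at \<open>t = x / p\<close>.\<close>

lemma powr_exp_minus_le:
  fixes x p :: real
  assumes "0 < x" "0 < p"
  shows "x powr p * exp (- x) \<le> p powr p"
proof -
  have "ln (x / p) \<le> x / p - 1"
    using assms by (intro ln_le_minus_one) auto
  then have "p * (ln x - ln p) \<le> p * (x / p - 1)"
    using assms by (intro mult_left_mono) (auto simp: ln_div)
  then have "p * ln x - x \<le> p * ln p"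
    using assms by (simp add: algebra_simps)
  then have "exp (p * ln x - x) \<le> exp (p * ln p)"
    by simp
  then show ?thesis
    using assms by (simp add: powr_def exp_diff exp_minus divide_inverse)
qed

lemma integrable_powr_tail:
  fixes q :: real
  assumes "0 < q"
  shows "integrable lborel (\<lambda>v. indicator {1..} v * v powr (- q - 1))"
proof -
  have lim: "((\<lambda>v. - (v powr - q) / q) \<longlongrightarrow> - 0 / q) at_top"
    using assms by (intro tendsto_intros tendsto_neg_powr filterlim_ident) auto
  have "(\<integral>\<^sup>+ v. ennreal (v powr (- q - 1)) * indicator {1..} v \<partial>lborel)
      = - 0 / q - (- (1 powr - q) / q)"
  proof (rule nn_integral_FTC_atLeast [OF _ _ _ lim])
    fix x :: real assume "1 \<le> x"
    then show "((\<lambda>v. - (v powr - q) / q) has_real_derivative x powr (- q - 1)) (at x)"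
      using assms by (auto intro!: derivative_eq_intros)
  qed auto
  then have "(\<integral>\<^sup>+ v. ennreal (indicator {1..} v * v powr (- q - 1)) \<partial>lborel) = ennreal (1 / q)"
    by (subst (asm) nn_integral_cong [where v = "\<lambda>v. ennreal (indicator {1..} v * v powr (- q - 1))"])
       (auto simp: indicator_def)
  then show ?thesis
    by (intro integrableI_nn_integral_finite [where x = "1 / q"]) (auto simp: assms less_imp_le)
qed

text \<open>Below 1 the kernel is bounded, by the previous estimate at \<open>1 / v\<close> with
  exponent \<open>q + 1\<close>. From 1 on, the exponential is at most 1 and an integrable power
  remains.\<close>

lemma integrable_inv_gamma_kernel:
  assumes "0 < q"
  shows "integrable lborel (inv_gamma_kernel q)"
proof (rule Bochner_Integration.integrable_bound)
  show "integrable lborel (\<lambda>v::real. (q + 1) powr (q + 1) * indicator {0..<1} v + indicator {1..} v * v powr (- q - 1))"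
    using integrable_powr_tail [OF assms] by (intro Bochner_Integration.integrable_add) auto
  show "AE v in lborel. norm (inv_gamma_kernel q v) \<le>
      norm ((q + 1) powr (q + 1) * indicator {0..<1} v + indicator {1..} v * v powr (- q - 1))"
  proof (rule AE_I2)
    fix v :: real
    have "inv_gamma_kernel q v \<le> (q + 1) powr (q + 1) * indicator {0..<1} v + indicator {1..} v * v powr (- q - 1)"
    proof (cases "0 < v")
      case False
      then show ?thesis by (simp add: inv_gamma_kernel_def indicator_def)
    next
      case pos: True
      show ?thesis
      proof (cases "v < 1")
        case True
        have "(1 / v) powr (q + 1) * exp (- (1 / v)) \<le> (q + 1) powr (q + 1)"
          using pos assms by (intro powr_exp_minus_le) auto
        moreover have "(1 / v) powr (q + 1) = v powr (- q - 1)"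
          using pos by (simp add: powr_divide powr_minus_divide [of v "q + 1", simplified])
        ultimately show ?thesis
          using pos True by (simp add: inv_gamma_kernel_def)
      next
        case False
        then have "v powr (- q - 1) * exp (- 1 / v) \<le> v powr (- q - 1) * 1"
          by (intro mult_left_mono) auto
        then show ?thesis
          using False by (simp add: inv_gamma_kernel_def indicator_def)
      qed
    qed
    then show "norm (inv_gamma_kernel q v) \<le>
      norm ((q + 1) powr (q + 1) * indicator {0..<1} v + indicator {1..} v * v powr (- q - 1))"
      using inv_gamma_kernel_nonneg [of q v] by simp
  qed
qed simp

text \<open>If the integral vanished, \<open>f\<close> would be 0 almost everywhere and the open
  unit interval would be a null set.\<close>

lemma integral_pos_of_pos_on_positive_reals:
  fixes f :: "real \<Rightarrow> real"
  assumes f: "integrable lborel f" "\<And>x. 0 \<le> f x" and pos: "\<And>x. 0 < x \<Longrightarrow> 0 < f x"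
  shows "0 < (\<integral>x. f x \<partial>lborel)"
proof -
  have "\<not> (AE x in lborel. f x = 0)"
  proof
    assume "AE x in lborel. f x = 0"
    then have "AE x in lborel. x \<notin> {0<..<1::real}"
    proof eventually_elim
      case (elim x)
      then show ?case using pos [of x] by auto
    qed
    then have "{0<..<1::real} \<in> null_sets lborel"
      by (subst (asm) AE_iff_null_sets [symmetric]) auto
    then show False by (simp add: null_sets_def)
  qed
  then have "(\<integral>x. f x \<partial>lborel) \<noteq> 0"
    using integral_nonneg_eq_0_iff_AE [OF f(1)] f(2) by auto
  then show ?thesis
    using f(2) by (simp add: less_le integral_nonneg_AE)
qed

lemma integral_inv_gamma_kernel_pos:
  "0 < q \<Longrightarrow> 0 < (\<integral>v. inv_gamma_kernel q v \<partial>lborel)"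
  by (intro integral_pos_of_pos_on_positive_reals integrable_inv_gamma_kernel
      inv_gamma_kernel_nonneg inv_gamma_kernel_pos)

text \<open>The functional equation of the Gamma function, by integration by parts: the difference
  of the two integrands is the derivative of \<open>v powr - q * exp (- 1 / v)\<close>, which
  vanishes at 0 and at infinity.\<close>

lemma integral_inv_gamma_kernel_Suc:
  assumes q: "0 < q"
  shows "(\<integral>v. inv_gamma_kernel (q + 1) v \<partial>lborel) = q * (\<integral>v. inv_gamma_kernel q v \<partial>lborel)"
proof -
  let ?f = "\<lambda>v::real. v powr (- (q + 1) - 1) * exp (- 1 / v) - q * (v powr (- q - 1) * exp (- 1 / v))"
  have eq: "indicator {0<..} v *\<^sub>R ?f v = inv_gamma_kernel (q + 1) v - q * inv_gamma_kernel q v" for v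
    by (simp add: inv_gamma_kernel_def algebra_simps)
  have int: "integrable lborel (inv_gamma_kernel (q + 1))" "integrable lborel (inv_gamma_kernel q)"
    using q by (auto intro: integrable_inv_gamma_kernel)
  have "(LBINT v=0..\<infinity>. ?f v) = 0 - 0"
  proof (rule interval_integral_FTC_integrable [where F = "\<lambda>v. v powr - q * exp (- 1 / v)"])
    fix x :: real assume "0 < ereal x"
    then have x: "0 < x" by simp
    have "((\<lambda>v. v powr - q * exp (- 1 / v)) has_real_derivative ?f x) (at x)"
      using x by (auto intro!: derivative_eq_intros simp: powr_diff field_simps power2_eq_square)
    then show "((\<lambda>v. v powr - q * exp (- 1 / v)) has_vector_derivative ?f x) (at x)"
      by (simp add: has_real_derivative_iff_has_vector_derivative)
    show "isCont ?f x"
      using x by (intro continuous_intros) auto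
  next
    show "set_integrable lborel (einterval 0 \<infinity>) ?f"
    proof -
      have "einterval 0 \<infinity> = {0<..}"
        by (auto simp: einterval_def zero_ereal_def)
      then show ?thesis
        using int unfolding set_integrable_def by (simp only: eq) simp
    qed
  next
    have "((\<lambda>v. v powr - q * exp (- 1 / v)) \<longlongrightarrow> 0) (at_right 0)"
      using q by real_asymp
    then show "(((\<lambda>v. v powr - q * exp (- 1 / v)) \<circ> real_of_ereal) \<longlongrightarrow> 0) (at_right 0)"
      unfolding zero_ereal_def by (simp only: ereal_tendsto_simps)
    have "((\<lambda>v. v powr - q * exp (- 1 / v)) \<longlongrightarrow> 0) at_top"
      using q by real_asymp
    then show "(((\<lambda>v. v powr - q * exp (- 1 / v)) \<circ> real_of_ereal) \<longlongrightarrow> 0) (at_left \<infinity>)"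
      by (simp add: ereal_tendsto_simps)
  qed simp
  moreover have "(LBINT v=0..\<infinity>. ?f v) = (\<integral>v. inv_gamma_kernel (q + 1) v - q * inv_gamma_kernel q v \<partial>lborel)"
    by (subst zero_ereal_def, subst interval_integral_to_infinity_eq)
       (simp only: set_lebesgue_integral_def eq)
  ultimately show ?thesis
    using int by simp
qed

section \<open>Integrability of the prior weight\<close>

lemma shrinkage_weight_eq:
  "shrinkage_weight a 0 \<gamma> L u
    = indicator {0<..} u * (u powr (a - 1) / (1 + u) powr a * log_factor \<gamma> L (1 + u))"
  by (simp add: shrinkage_weight_def log_factor_def)

lemma measurable_shrinkage_weight [measurable]:
  "shrinkage_weight a b \<gamma> L \<in> borel_measurable borel"
  unfolding shrinkage_weight_def by measurable

lemma shrinkage_weight_pos: "0 < u \<Longrightarrow> 0 < shrinkage_weight a 0 \<gamma> L u"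
  using log_factor_pos [of "1 + u" \<gamma> L] by (simp add: shrinkage_weight_eq)

lemma shrinkage_weight_nonneg: "0 \<le> shrinkage_weight a 0 \<gamma> L u"
  using shrinkage_weight_pos [of u a \<gamma> L]
  by (cases "0 < u") (auto simp: shrinkage_weight_eq)

text \<open>Handles both signs of the exponent at once. It is meant for \<open>p = a - 1\<close> and
  for \<open>r = u / (1 + u)\<close>, which is at least 1/2 exactly when
  \<open>u \<ge> 1\<close>.\<close>

lemma powr_half_bound:
  fixes r p :: real
  assumes "1 / 2 \<le> r" "r \<le> 1"
  shows "r powr p \<le> 1 + (1 / 2) powr p"
proof (cases "0 \<le> p")
  case True
  then have "r powr p \<le> 1 powr p" using assms by (intro powr_mono2) auto
  then show ?thesis by (simp add: add_increasing2)
next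
  case False
  then have "r powr p \<le> (1 / 2) powr p" using assms by (intro powr_mono2') auto
  then show ?thesis by simp
qed

text \<open>The integrand is the derivative of
  \<open>- (iter_log L (1 + u) powr - \<gamma>) / \<gamma>\<close>, which converges at infinity
  because \<open>\<gamma> > 0\<close>.\<close>

lemma integrable_log_factor:
  assumes "0 < \<gamma>" "1 \<le> L"
  shows "integrable lborel (\<lambda>u. indicator {1..} u * (log_factor \<gamma> L (1 + u) / (1 + u)))"
proof -
  let ?F = "\<lambda>u. - (iter_log L (1 + u) powr - \<gamma>) / \<gamma>"
  have one: "filterlim (\<lambda>u::real. 1 + u) at_top at_top"
    by real_asymp
  have lim: "(?F \<longlongrightarrow> - 0 / \<gamma>) at_top"
    using assms one
    by (intro tendsto_intros tendsto_neg_powr filterlim_compose [OF iter_log_at_top]) auto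
  have "(\<integral>\<^sup>+ u. ennreal (log_factor \<gamma> L (1 + u) / (1 + u)) * indicator {1..} u \<partial>lborel)
      = - 0 / \<gamma> - ?F 1"
  proof (rule nn_integral_FTC_atLeast [OF _ _ _ lim])
    fix x :: real assume x: "1 \<le> x"
    then have pos: "0 < iter_log L (1 + x)"
      by (intro iter_log_pos) simp
    have "((\<lambda>u. iter_log L (1 + u)) has_real_derivative (\<Prod>j<L. 1 / iter_log j (1 + x)) * 1) (at x)"
      using x by (intro DERIV_chain2 [OF iter_log_deriv]) (auto intro!: derivative_eq_intros)
    then have "(?F has_real_derivative
        iter_log L (1 + x) powr (- \<gamma> - 1) * (\<Prod>j<L. 1 / iter_log j (1 + x))) (at x)"
      using pos assms by (auto intro!: derivative_eq_intros)
    \<comment> \<open>The factor with index 0 is \<open>1 / (1 + x)\<close>, as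
      \<open>iter_log 0\<close> is the identity; the others form the product in
      \<open>log_factor\<close>.\<close>
    also have "(\<Prod>j<L. 1 / iter_log j (1 + x)) = 1 / (1 + x) * (\<Prod>j\<in>{1..<L}. 1 / iter_log j (1 + x))"
      using assms by (simp add: lessThan_atLeast0 prod.atLeast_Suc_lessThan)
    also have "iter_log L (1 + x) powr (- \<gamma> - 1) * (1 / (1 + x) * (\<Prod>j\<in>{1..<L}. 1 / iter_log j (1 + x)))
        = log_factor \<gamma> L (1 + x) / (1 + x)"
    proof -
      have "- \<gamma> - 1 = - (1 + \<gamma>)" by simp
      then show ?thesis
        by (simp only: powr_minus_divide log_factor_def) simp
    qed
    finally show "(?F has_real_derivative log_factor \<gamma> L (1 + x) / (1 + x)) (at x)" .
    show "0 \<le> log_factor \<gamma> L (1 + x) / (1 + x)"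
      using x log_factor_pos [of "1 + x" \<gamma> L] by simp
  qed auto
  then have "(\<integral>\<^sup>+ u. ennreal (indicator {1..} u * (log_factor \<gamma> L (1 + u) / (1 + u))) \<partial>lborel) = ennreal (- ?F 1)"
    by (subst (asm) nn_integral_cong [where v = "\<lambda>u. ennreal (indicator {1..} u * (log_factor \<gamma> L (1 + u) / (1 + u)))"])
       (auto simp: indicator_def)
  moreover have "0 \<le> log_factor \<gamma> L (1 + u) / (1 + u)" if "1 \<le> u" for u
    using that log_factor_pos [of "1 + u" \<gamma> L] by simp
  ultimately show ?thesis
    by (intro integrableI_nn_integral_finite [where x = "- ?F 1"])
       (auto simp: assms less_imp_le indicator_def)
qed

lemma integrable_powr_unit:
  fixes a :: real
  assumes "0 < a"
  shows "integrable lborel (\<lambda>u. indicator {0..1} u * u powr (a - 1))"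
proof -
  have "((\<lambda>u. u powr (a - 1)) has_integral (1 powr (a - 1 + 1) / (a - 1 + 1))) {0..1}"
    using assms by (intro has_integral_powr_from_0) auto
  then have "(\<lambda>u. u powr (a - 1)) absolutely_integrable_on {0..1}"
    by (intro nonnegative_absolutely_integrable_1) auto
  then have "integrable lebesgue (\<lambda>u. indicator {0..1} u * u powr (a - 1))"
    by (simp add: set_integrable_def)
  then show ?thesis
    by (subst (asm) integrable_completion) auto
qed

text \<open>Below 1 the weight is at most \<open>u powr (a - 1)\<close>, integrable since
  \<open>a > 0\<close>. From 1 on, its power part is at most a constant over \<open>1 + u\<close>,
  and the log factor makes the tail converge.\<close>

lemma integrable_shrinkage_weight:
  assumes "0 < a" "0 < \<gamma>" "1 \<le> L"
  shows "integrable lborel (shrinkage_weight a 0 \<gamma> L)"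
proof (rule Bochner_Integration.integrable_bound)
  let ?C = "1 + (1 / 2) powr (a - 1)"
  let ?g = "\<lambda>u. indicator {0..1} u * u powr (a - 1)
      + ?C * (indicator {1..} u * (log_factor \<gamma> L (1 + u) / (1 + u)))"
  show "integrable lborel ?g"
    using integrable_log_factor [OF assms(2,3)] integrable_powr_unit [OF assms(1)]
    by (intro Bochner_Integration.integrable_add integrable_mult_right)
  show "AE u in lborel. norm (shrinkage_weight a 0 \<gamma> L u) \<le> norm (?g u)"
  proof (rule AE_I2)
    fix u :: real
    have "shrinkage_weight a 0 \<gamma> L u \<le> ?g u"
    proof (cases "u < 1")
      case True
      show ?thesis
      proof (cases "0 < u")
        case u: True
        have "u powr (a - 1) / (1 + u) powr a * log_factor \<gamma> L (1 + u) \<le> u powr (a - 1) / 1 * 1"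
          using u assms log_factor_pos [of "1 + u" \<gamma> L] log_factor_le_1 [of "1 + u" \<gamma> L]
          by (intro mult_mono divide_left_mono) (auto simp: ge_one_powr_ge_zero)
        then show ?thesis
          using u True by (simp add: shrinkage_weight_eq)
      qed (simp add: shrinkage_weight_eq)
    next
      case False
      then have u: "1 \<le> u" by simp
      have "u powr (a - 1) / (1 + u) powr a = (u / (1 + u)) powr (a - 1) / (1 + u)"
        using u powr_mult_base [of "1 + u" "a - 1"] by (simp add: powr_divide mult.commute)
      also have "\<dots> \<le> ?C / (1 + u)"
        using u by (intro divide_right_mono powr_half_bound) (auto simp: field_simps)
      finally have "u powr (a - 1) / (1 + u) powr a * log_factor \<gamma> L (1 + u)
          \<le> ?C / (1 + u) * log_factor \<gamma> L (1 + u)"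
        using u log_factor_pos [of "1 + u" \<gamma> L] by (intro mult_right_mono) auto
      then have "shrinkage_weight a 0 \<gamma> L u
          \<le> ?C * (indicator {1..} u * (log_factor \<gamma> L (1 + u) / (1 + u)))"
        using u by (simp add: shrinkage_weight_eq)
      then show ?thesis
        by (simp add: add_increasing)
    qed
    then show "norm (shrinkage_weight a 0 \<gamma> L u) \<le> norm (?g u)"
      using shrinkage_weight_nonneg [of a \<gamma> L u] by simp
  qed
qed simp

section \<open>Asymptotics of the marginal integrals\<close>

text \<open>At \<open>q = 1/2\<close> and \<open>s = y\<^sup>2 / 2\<close> this is, up to
  \<open>1 / sqrt (2 * pi)\<close>, the weight times the \<open>N(0, 1 + u)\<close> density of
  \<open>y\<close>. Larger \<open>q\<close> account for powers of \<open>1 / (1 + u)\<close> in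
  posterior moments.\<close>

definition marginal_integrand :: "real \<Rightarrow> real \<Rightarrow> nat \<Rightarrow> real \<Rightarrow> real \<Rightarrow> real \<Rightarrow> real" where
  "marginal_integrand a \<gamma> L q s u
    = shrinkage_weight a 0 \<gamma> L u * ((1 + u) powr - q * exp (- s / (1 + u)))"

lemma measurable_marginal_integrand [measurable]:
  "marginal_integrand a \<gamma> L q s \<in> borel_measurable borel"
  unfolding marginal_integrand_def by measurable

lemma marginal_integrand_nonneg: "0 \<le> marginal_integrand a \<gamma> L q s u"
  by (simp add: marginal_integrand_def shrinkage_weight_nonneg)

lemma marginal_integrand_nonpos_arg: "u \<le> 0 \<Longrightarrow> marginal_integrand a \<gamma> L q s u = 0"
  by (simp add: marginal_integrand_def shrinkage_weight_eq)

lemma integrable_marginal_integrand: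
  assumes "0 < a" "0 < \<gamma>" "1 \<le> L" "0 \<le> q" "0 \<le> s"
  shows "integrable lborel (marginal_integrand a \<gamma> L q s)"
proof (rule Bochner_Integration.integrable_bound [OF integrable_shrinkage_weight [OF assms(1-3)]])
  show "AE u in lborel. norm (marginal_integrand a \<gamma> L q s u) \<le> norm (shrinkage_weight a 0 \<gamma> L u)"
  proof (rule AE_I2)
    fix u :: real
    show "norm (marginal_integrand a \<gamma> L q s u) \<le> norm (shrinkage_weight a 0 \<gamma> L u)"
    proof (cases "0 < u")
      case True
      have "(1 + u) powr - q * exp (- s / (1 + u)) \<le> 1 * 1"
        using True assms by (intro mult_mono) (auto simp: powr_minus divide_simps ge_one_powr_ge_zero)
      then have "marginal_integrand a \<gamma> L q s u \<le> shrinkage_weight a 0 \<gamma> L u * 1"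
        unfolding marginal_integrand_def
        by (intro mult_left_mono) (auto simp: shrinkage_weight_nonneg)
      then show ?thesis
        using marginal_integrand_nonneg [of a \<gamma> L q s u] shrinkage_weight_nonneg [of a \<gamma> L u] by simp
    qed (simp add: marginal_integrand_nonpos_arg)
  qed
qed simp

text \<open>For \<open>u < 1\<close> the exponential is at most \<open>exp (- s / 2)\<close>, which
  beats the prefactor: the latter grows at most polynomially in \<open>s\<close>.\<close>

lemma marginal_head_tendsto_0:
  assumes "0 < a" "0 < \<gamma>" "1 \<le> L" "0 \<le> q"
  shows "((\<lambda>s. s powr q / log_factor \<gamma> L s *
      (\<integral>u. indicator {..<1} u * marginal_integrand a \<gamma> L q s u \<partial>lborel)) \<longlongrightarrow> 0) at_top"
proof (rule tendsto_sandwich [OF _ _ tendsto_const])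
  let ?W = "\<integral>u. shrinkage_weight a 0 \<gamma> L u \<partial>lborel"
  show "((\<lambda>s. s powr (q + (real L + \<gamma>)) * (exp (- s / 2) * ?W)) \<longlongrightarrow> 0) at_top"
  proof -
    have "((\<lambda>s. s powr (q + (real L + \<gamma>)) * exp (- s / 2)) \<longlongrightarrow> 0) at_top"
      by real_asymp
    from tendsto_mult_left_zero [OF this, of ?W] show ?thesis
      by (simp only: mult.assoc)
  qed
  show "\<forall>\<^sub>F s in at_top. 0 \<le> s powr q / log_factor \<gamma> L s *
      (\<integral>u. indicator {..<1} u * marginal_integrand a \<gamma> L q s u \<partial>lborel)"
    using eventually_ge_at_top [of 1]
    by eventually_elim
       (auto intro!: mult_nonneg_nonneg divide_nonneg_nonneg integral_nonneg_AE AE_I2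
         simp: marginal_integrand_nonneg log_factor_pos less_imp_le)
  show "\<forall>\<^sub>F s in at_top. s powr q / log_factor \<gamma> L s *
      (\<integral>u. indicator {..<1} u * marginal_integrand a \<gamma> L q s u \<partial>lborel)
      \<le> s powr (q + (real L + \<gamma>)) * (exp (- s / 2) * ?W)"
    using eventually_ge_at_top [of 1]
  proof eventually_elim
    case (elim s)
    \<comment> \<open>At the base point 1 every iterated logarithm equals 1, hence so does the log
      factor.\<close>
    have "log_factor \<gamma> L 1 * s powr - (real L + \<gamma>) \<le> log_factor \<gamma> L (1 * s)"
      using elim assms by (intro log_factor_mult_ge) auto
    then have "s powr - (real L + \<gamma>) \<le> log_factor \<gamma> L s"
      by (simp add: log_factor_def)
    then have "s powr q / log_factor \<gamma> L s \<le> s powr q / s powr - (real L + \<gamma>)"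
      using elim log_factor_pos [of s \<gamma> L] by (intro divide_left_mono) auto
    also have "\<dots> = s powr (q + (real L + \<gamma>))"
      by (simp only: powr_diff [symmetric] diff_minus_eq_add)
    finally have 1: "s powr q / log_factor \<gamma> L s \<le> s powr (q + (real L + \<gamma>))" .
    have "(\<integral>u. indicator {..<1} u * marginal_integrand a \<gamma> L q s u \<partial>lborel)
        \<le> (\<integral>u. exp (- s / 2) * shrinkage_weight a 0 \<gamma> L u \<partial>lborel)"
    proof (rule integral_mono')
      show "integrable lborel (\<lambda>u. exp (- s / 2) * shrinkage_weight a 0 \<gamma> L u)"
        using integrable_shrinkage_weight [OF assms(1-3)] by simp
      fix u :: real
      show "0 \<le> exp (- s / 2) * shrinkage_weight a 0 \<gamma> L u"
        by (simp add: shrinkage_weight_nonneg)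
      show "indicator {..<1} u * marginal_integrand a \<gamma> L q s u \<le> exp (- s / 2) * shrinkage_weight a 0 \<gamma> L u"
      proof (cases "0 < u \<and> u < 1")
        case True
        have "(1 + u) powr - q * exp (- s / (1 + u)) \<le> 1 * exp (- s / 2)"
          using True assms elim
          by (intro mult_mono) (auto simp: powr_minus divide_simps ge_one_powr_ge_zero)
        then have "marginal_integrand a \<gamma> L q s u \<le> shrinkage_weight a 0 \<gamma> L u * (1 * exp (- s / 2))"
          unfolding marginal_integrand_def
          by (intro mult_left_mono) (auto simp: shrinkage_weight_nonneg)
        then show ?thesis using True by (simp add: mult.commute)
      qed (auto simp: marginal_integrand_nonpos_arg shrinkage_weight_nonneg indicator_def)
    qed
    also have "\<dots> = exp (- s / 2) * ?W" by simp
    finally have 2: "(\<integral>u. indicator {..<1} u * marginal_integrand a \<gamma> L q s u \<partial>lborel) \<le> exp (- s / 2) * ?W" .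
    show ?case
      using 1 2 by (intro mult_mono) (auto intro!: integral_nonneg_AE simp: marginal_integrand_nonneg)
  qed
qed

text \<open>On the left, \<open>s\<close> is the Jacobian of \<open>u = s * v - 1\<close> and
  \<open>s powr q\<close> the normalisation. The exponential becomes \<open>exp (- 1 / v)\<close>
  exactly; the power of \<open>1 - 1 / (s * v)\<close> is what remains of
  \<open>(u / (1 + u)) powr (a - 1)\<close>.\<close>

lemma scaled_marginal_integrand:
  assumes "1 \<le> s" "1 \<le> s * v - 1"
  shows "marginal_integrand a \<gamma> L q s (s * v - 1) * s * s powr q
    = inv_gamma_kernel q v * (1 - 1 / (s * v)) powr (a - 1) * log_factor \<gamma> L (s * v)"
proof -
  have v: "0 < v"
    using assms by (smt (verit) mult_nonneg_nonpos)
  have "(1 - 1 / (s * v)) powr (a - 1) = (s * v - 1) powr (a - 1) / (s * v) powr (a - 1)"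
    using assms v by (subst powr_divide [symmetric]) (auto simp: field_simps)
  also have "\<dots> = (s * v - 1) powr (a - 1) / (s * v) powr a * (s * v)"
    using assms v by (simp add: powr_diff)
  finally have 1: "(1 - 1 / (s * v)) powr (a - 1) = (s * v - 1) powr (a - 1) / (s * v) powr a * (s * v)" .
  have 2: "(s * v) powr - q * s powr q = v powr - q"
    using assms v by (simp add: powr_mult powr_minus)
  have 3: "v powr (- q - 1) * v = v powr - q"
    using v by (simp add: powr_diff)
  have "marginal_integrand a \<gamma> L q s (s * v - 1) * s * s powr q
      = (s * v - 1) powr (a - 1) / (s * v) powr a * log_factor \<gamma> L (s * v) * exp (- 1 / v)
        * s * ((s * v) powr - q * s powr q)"
    using assms by (simp add: marginal_integrand_def shrinkage_weight_eq)
  also have "\<dots> = inv_gamma_kernel q v * (1 - 1 / (s * v)) powr (a - 1) * log_factor \<gamma> L (s * v)"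
    unfolding 1 2 3 [symmetric] using v by (simp add: inv_gamma_kernel_def)
  finally show ?thesis .
qed

text \<open>The substitution \<open>1 + u = s v\<close> rescales the integrand to the inverse gamma kernel. The
  dominating function comes from submultiplicativity of the iterated logarithms, and \<open>u \<ge> 1\<close>
  keeps \<open>1 - 1 / (s v)\<close> away from the singularity present for \<open>a < 1\<close>.\<close>

lemma marginal_tail_tendsto:
  assumes "0 < a" "0 < \<gamma>" "1 \<le> L" "0 < q"
  shows "((\<lambda>s. s powr q / log_factor \<gamma> L s *
      (\<integral>u. indicator {1..} u * marginal_integrand a \<gamma> L q s u \<partial>lborel))
    \<longlongrightarrow> (\<integral>v. inv_gamma_kernel q v \<partial>lborel)) at_top"
proof -
  define G where "G = (\<lambda>s v. indicator {1..} (s * v - 1) * (inv_gamma_kernel q v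
      * (1 - 1 / (s * v)) powr (a - 1) * (log_factor \<gamma> L (s * v) / log_factor \<gamma> L s)))"
  let ?C = "1 + (1 / 2) powr (a - 1)"
  \<comment> \<open>In the dominating function \<open>?C\<close> bounds the power of
    \<open>1 - 1 / (s * v)\<close>. The two kernels come from the two summands in
    \<open>log_factor_ratio_le\<close>, the second raising \<open>q\<close> by
    \<open>real L + \<gamma>\<close>.\<close>
  have "((\<lambda>s. \<integral>v. G s v \<partial>lborel) \<longlongrightarrow> (\<integral>v. inv_gamma_kernel q v \<partial>lborel)) at_top"
  proof (rule integral_dominated_convergence_at_top
      [where w = "\<lambda>v. ?C * (inv_gamma_kernel q v + inv_gamma_kernel (q + (real L + \<gamma>)) v)"])
    show "integrable lborel (\<lambda>v. ?C * (inv_gamma_kernel q v + inv_gamma_kernel (q + (real L + \<gamma>)) v))"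
      using assms by (auto intro!: integrable_inv_gamma_kernel)
    show "AE v in lborel. ((\<lambda>s. G s v) \<longlongrightarrow> inv_gamma_kernel q v) at_top"
    proof (rule AE_I2)
      fix v :: real
      show "((\<lambda>s. G s v) \<longlongrightarrow> inv_gamma_kernel q v) at_top"
      proof (cases "0 < v")
        case True
        have "((\<lambda>s. (1 - 1 / (s * v)) powr (a - 1)) \<longlongrightarrow> 1 powr (a - 1)) at_top"
          using True by (intro tendsto_powr tendsto_const) (real_asymp | simp)+
        then have "((\<lambda>s. inv_gamma_kernel q v * (1 - 1 / (s * v)) powr (a - 1)
            * (log_factor \<gamma> L (s * v) / log_factor \<gamma> L s)) \<longlongrightarrow> inv_gamma_kernel q v * 1 powr (a - 1) * 1) at_top"
          using True assms by (intro tendsto_mult tendsto_const log_factor_ratio_tendsto) auto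
        \<comment> \<open>Once \<open>s \<ge> 2 / v\<close> the indicator in \<open>G\<close> equals
          1.\<close>
        moreover have "\<forall>\<^sub>F s in at_top. inv_gamma_kernel q v * (1 - 1 / (s * v)) powr (a - 1)
            * (log_factor \<gamma> L (s * v) / log_factor \<gamma> L s) = G s v"
          using eventually_ge_at_top [of "2 / v"]
          by eventually_elim (use True in \<open>auto simp: G_def indicator_def field_simps\<close>)
        ultimately show ?thesis
          using Lim_transform_eventually by fastforce
      qed (simp add: G_def inv_gamma_kernel_def)
    qed
    show "\<forall>\<^sub>F s in at_top. AE v in lborel.
        norm (G s v) \<le> ?C * (inv_gamma_kernel q v + inv_gamma_kernel (q + (real L + \<gamma>)) v)"
      using eventually_ge_at_top [of 1]
    proof eventually_elim
      case (elim s)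
      show ?case
      proof (rule AE_I2)
        fix v :: real
        show "norm (G s v) \<le> ?C * (inv_gamma_kernel q v + inv_gamma_kernel (q + (real L + \<gamma>)) v)"
        proof (cases "1 \<le> s * v - 1")
          case True
          then have v: "0 < v"
            using elim by (smt (verit) mult_nonneg_nonpos)
          have "G s v = inv_gamma_kernel q v * (1 - 1 / (s * v)) powr (a - 1)
              * (log_factor \<gamma> L (s * v) / log_factor \<gamma> L s)"
            using True by (simp add: G_def)
          moreover have "(1 - 1 / (s * v)) powr (a - 1) \<le> ?C"
            using True by (intro powr_half_bound) (auto simp: field_simps)
          moreover have "log_factor \<gamma> L (s * v) / log_factor \<gamma> L s \<le> 1 + v powr - (real L + \<gamma>)"
            using True elim v assms by (intro log_factor_ratio_le) auto
          moreover have "0 \<le> log_factor \<gamma> L (s * v) / log_factor \<gamma> L s"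
            using True elim log_factor_pos [of "s * v" \<gamma> L] log_factor_pos [of s \<gamma> L] by simp
          moreover have "0 \<le> G s v"
            using calculation by (simp only: mult_nonneg_nonneg inv_gamma_kernel_nonneg powr_ge_zero)
          ultimately have "norm (G s v) \<le> inv_gamma_kernel q v * ?C * (1 + v powr - (real L + \<gamma>))"
            unfolding real_norm_def by (simp only: abs_of_nonneg)
              (intro mult_mono mult_nonneg_nonneg add_nonneg_nonneg inv_gamma_kernel_nonneg powr_ge_zero order_refl; simp)
          also have "\<dots> = ?C * (inv_gamma_kernel q v + inv_gamma_kernel q v * v powr - (real L + \<gamma>))"
            by algebra
          also have "inv_gamma_kernel q v * v powr - (real L + \<gamma>) = inv_gamma_kernel (q + (real L + \<gamma>)) v"
          proof -
            have "v powr (- q - 1) * v powr - (real L + \<gamma>) = v powr (- (q + (real L + \<gamma>)) - 1)"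
              by (simp only: powr_add [symmetric]) (simp add: algebra_simps)
            then show ?thesis by (simp add: inv_gamma_kernel_def)
          qed
          finally show ?thesis .
        qed (simp add: G_def inv_gamma_kernel_nonneg)
      qed
    qed
  qed (auto simp: G_def)
  moreover have "\<forall>\<^sub>F s in at_top. (\<integral>v. G s v \<partial>lborel) = s powr q / log_factor \<gamma> L s *
      (\<integral>u. indicator {1..} u * marginal_integrand a \<gamma> L q s u \<partial>lborel)"
    using eventually_ge_at_top [of 1]
  proof eventually_elim
    case (elim s)
    have "(\<integral>u. indicator {1..} u * marginal_integrand a \<gamma> L q s u \<partial>lborel)
        = s * (\<integral>v. indicator {1..} (s * v - 1) * marginal_integrand a \<gamma> L q s (s * v - 1) \<partial>lborel)"
      using elim by (subst lborel_integral_real_affine [where c = s and t = "- 1"]) auto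
    then have "s powr q / log_factor \<gamma> L s *
      (\<integral>u. indicator {1..} u * marginal_integrand a \<gamma> L q s u \<partial>lborel)
      = (\<integral>v. s powr q / log_factor \<gamma> L s * s * (indicator {1..} (s * v - 1) * marginal_integrand a \<gamma> L q s (s * v - 1)) \<partial>lborel)"
      by simp
    also have "\<dots> = (\<integral>v. G s v \<partial>lborel)"
    proof (rule Bochner_Integration.integral_cong [OF refl])
      fix v :: real
      show "s powr q / log_factor \<gamma> L s * s * (indicator {1..} (s * v - 1) * marginal_integrand a \<gamma> L q s (s * v - 1)) = G s v"
      proof (cases "1 \<le> s * v - 1")
        case True
        then show ?thesis
          using scaled_marginal_integrand [OF elim True, of a \<gamma> L q]
          by (simp add: G_def mult_ac)
      qed (simp add: G_def)
    qed
    finally show ?case by simp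
  qed
  ultimately show ?thesis
    by (rule Lim_transform_eventually)
qed

lemma marginal_tendsto:
  assumes "0 < a" "0 < \<gamma>" "1 \<le> L" "0 < q"
  shows "((\<lambda>s. s powr q / log_factor \<gamma> L s * (\<integral>u. marginal_integrand a \<gamma> L q s u \<partial>lborel))
    \<longlongrightarrow> (\<integral>v. inv_gamma_kernel q v \<partial>lborel)) at_top"
proof -
  let ?m = "marginal_integrand a \<gamma> L q"
  have "((\<lambda>s. s powr q / log_factor \<gamma> L s * (\<integral>u. indicator {..<1} u * ?m s u \<partial>lborel)
      + s powr q / log_factor \<gamma> L s * (\<integral>u. indicator {1..} u * ?m s u \<partial>lborel))
    \<longlongrightarrow> 0 + (\<integral>v. inv_gamma_kernel q v \<partial>lborel)) at_top"
    using assms by (intro tendsto_add marginal_head_tendsto_0 marginal_tail_tendsto) auto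
  moreover have "\<forall>\<^sub>F s in at_top. s powr q / log_factor \<gamma> L s * (\<integral>u. indicator {..<1} u * ?m s u \<partial>lborel)
      + s powr q / log_factor \<gamma> L s * (\<integral>u. indicator {1..} u * ?m s u \<partial>lborel)
      = s powr q / log_factor \<gamma> L s * (\<integral>u. ?m s u \<partial>lborel)"
    using eventually_ge_at_top [of 0]
  proof eventually_elim
    case (elim s)
    have int: "integrable lborel (?m s)"
      using assms elim by (intro integrable_marginal_integrand) auto
    have "(\<integral>u. ?m s u \<partial>lborel) = (\<integral>u. indicator {..<1} u * ?m s u + indicator {1..} u * ?m s u \<partial>lborel)"
      by (intro Bochner_Integration.integral_cong) (auto simp: indicator_def)
    also have "\<dots> = (\<integral>u. indicator {..<1} u * ?m s u \<partial>lborel) + (\<integral>u. indicator {1..} u * ?m s u \<partial>lborel)"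
      using integrable_mult_indicator [OF _ int, of "{..<1}"] integrable_mult_indicator [OF _ int, of "{1..}"]
      by (intro Bochner_Integration.integral_add) auto
    finally show ?case by (simp add: distrib_left)
  qed
  ultimately show ?thesis
    using Lim_transform_eventually by fastforce
qed

text \<open>The normalisations for \<open>q + 1\<close> and \<open>q\<close> share the log factor
  and differ by exactly one \<open>s\<close>, so the limit is the ratio of the two kernel masses,
  which the functional equation evaluates to \<open>q\<close>.\<close>

lemma marginal_ratio_tendsto:
  assumes "0 < a" "0 < \<gamma>" "1 \<le> L" "0 < q"
  shows "((\<lambda>s. s * ((\<integral>u. marginal_integrand a \<gamma> L (q + 1) s u \<partial>lborel)
      / (\<integral>u. marginal_integrand a \<gamma> L q s u \<partial>lborel))) \<longlongrightarrow> q) at_top"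
proof -
  let ?I = "\<lambda>q s. \<integral>u. marginal_integrand a \<gamma> L q s u \<partial>lborel"
  let ?M = "\<lambda>q. \<integral>v. inv_gamma_kernel q v \<partial>lborel"
  have M: "0 < ?M q" "?M (q + 1) = q * ?M q"
    using assms by (auto intro!: integral_inv_gamma_kernel_pos integral_inv_gamma_kernel_Suc)
  have "((\<lambda>s. (s powr (q + 1) / log_factor \<gamma> L s * ?I (q + 1) s) / (s powr q / log_factor \<gamma> L s * ?I q s))
      \<longlongrightarrow> ?M (q + 1) / ?M q) at_top"
    using assms M by (intro tendsto_divide marginal_tendsto) auto
  moreover have "\<forall>\<^sub>F s in at_top. (s powr (q + 1) / log_factor \<gamma> L s * ?I (q + 1) s) / (s powr q / log_factor \<gamma> L s * ?I q s)
      = s * (?I (q + 1) s / ?I q s)"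
    using eventually_ge_at_top [of 1]
  proof eventually_elim
    case (elim s)
    then show ?case
      using log_factor_pos [OF elim, of \<gamma> L] by (simp add: powr_add)
  qed
  ultimately show ?thesis
    using M Lim_transform_eventually by fastforce
qed

section \<open>From Bayes' rule to a formula for the MSE\<close>

text \<open>Conjugacy, by completing the square in \<open>\<theta>\<close>: likelihood times prior
  equals the marginal density of \<open>y\<close> times the posterior density of
  \<open>\<theta>\<close>, all given \<open>u\<close>.\<close>

lemma normal_density_product:
  assumes "0 < u"
  shows "normal_density \<theta> 1 y * normal_density 0 (sqrt u) \<theta>
    = normal_density 0 (sqrt (1 + u)) y * normal_density (u * y / (1 + u)) (sqrt (u / (1 + u))) \<theta>"
proof -
  have "sqrt (2 * pi) * sqrt (2 * pi * u) = sqrt (2 * pi * (1 + u)) * sqrt (2 * pi * (u / (1 + u)))"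
    using assms by (simp add: real_sqrt_mult [symmetric])
  moreover have "- (y - \<theta>)\<^sup>2 / 2 + - \<theta>\<^sup>2 / (2 * u)
      = - y\<^sup>2 / (2 * (1 + u)) + - (\<theta> - u * y / (1 + u))\<^sup>2 / (2 * (u / (1 + u)))"
    using assms by (simp add: divide_simps power2_eq_square) (simp add: algebra_simps)
  ultimately show ?thesis
    using assms by (simp add: normal_density_def mult_exp_exp)
qed

text \<open>Variance plus squared bias: \<open>(x - y)\<^sup>2\<close> is expanded about
  \<open>\<mu>\<close> and the central moments of order 0, 1 and 2 are inserted.\<close>

lemma normal_second_moment:
  assumes "0 < \<sigma>"
  shows "has_bochner_integral lborel (\<lambda>x. normal_density \<mu> \<sigma> x * (x - y)\<^sup>2) (\<sigma>\<^sup>2 + (\<mu> - y)\<^sup>2)"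
proof -
  have 0: "has_bochner_integral lborel (\<lambda>x. normal_density \<mu> \<sigma> x) 1"
    using normal_moment_even [OF assms, of \<mu> 0] by simp
  have 1: "has_bochner_integral lborel (\<lambda>x. normal_density \<mu> \<sigma> x * (x - \<mu>)) 0"
    using normal_moment_odd [OF assms, of \<mu> 0] by simp
  have 2: "has_bochner_integral lborel (\<lambda>x. normal_density \<mu> \<sigma> x * (x - \<mu>)\<^sup>2) (\<sigma>\<^sup>2)"
    using normal_moment_even [OF assms, of \<mu> 1] by simp
  have "has_bochner_integral lborel (\<lambda>x. normal_density \<mu> \<sigma> x * (x - \<mu>)\<^sup>2
      + normal_density \<mu> \<sigma> x * (x - \<mu>) * (2 * (\<mu> - y)) + normal_density \<mu> \<sigma> x * (\<mu> - y)\<^sup>2)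
      (\<sigma>\<^sup>2 + 0 * (2 * (\<mu> - y)) + 1 * (\<mu> - y)\<^sup>2)"
    by (intro has_bochner_integral_add has_bochner_integral_mult_left 0 1 2)
  then show ?thesis
    by (simp add: power2_eq_square algebra_simps)
qed

lemma normal_kernel_measurable [measurable]:
  "(\<lambda>u. density lborel (\<lambda>\<theta>. ennreal (normal_density 0 (sqrt u) \<theta>))) \<in> borel \<rightarrow>\<^sub>M subprob_algebra lborel"
proof (rule measurable_subprob_algebra)
  fix u :: real
  show "subprob_space (density lborel (\<lambda>\<theta>. ennreal (normal_density 0 (sqrt u) \<theta>)))"
  proof (cases "u = 0")
    case True
    \<comment> \<open>By division by zero the density vanishes here; for negative \<open>u\<close>, \<open>sqrt u\<close> is the
      negative root and the density is that of variance \<open>- u\<close>.\<close>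
    then show ?thesis
      by (intro subprob_spaceI) (auto simp: emeasure_density normal_density_def)
  next
    case False
    have "(\<lambda>\<theta>. ennreal (normal_density 0 (sqrt u) \<theta>)) = (\<lambda>\<theta>. ennreal (normal_density 0 \<bar>sqrt u\<bar> \<theta>))"
      by (simp add: normal_density_def)
    then show ?thesis
      using False by (simp only:) (intro prob_space_imp_subprob_space prob_space_normal_density, simp)
  qed
next
  fix A :: "real set" assume [measurable]: "A \<in> sets lborel"
  have [measurable]: "(\<lambda>(u, \<theta>). ennreal (normal_density 0 (sqrt u) \<theta>)) \<in> borel_measurable (borel \<Otimes>\<^sub>M lborel)"
    unfolding normal_density_def by measurable
  show "(\<lambda>u. emeasure (density lborel (\<lambda>\<theta>. ennreal (normal_density 0 (sqrt u) \<theta>))) A) \<in> borel_measurable borel"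
  proof -
    have "emeasure (density lborel (\<lambda>\<theta>. ennreal (normal_density 0 (sqrt u) \<theta>))) A
        = (\<integral>\<^sup>+ \<theta>. ennreal (normal_density 0 (sqrt u) \<theta>) * indicator A \<theta> \<partial>lborel)" for u
      by (rule emeasure_density) measurable
    then show ?thesis by (simp only:) measurable
  qed
qed simp

lemma sets_prior_u [simp, measurable_cong]: "sets (prior_u a b \<gamma> L) = sets borel"
  by (simp add: prior_u_def normalized_density_def)

lemma sets_prior_theta [simp, measurable_cong]: "sets (prior_theta a b \<gamma> L) = sets borel"
proof -
  have "space (prior_u a b \<gamma> L) \<noteq> {}"
    using sets_eq_imp_space_eq [OF sets_prior_u [of a b \<gamma> L]] by simp
  then show ?thesis
    unfolding prior_theta_def by (subst sets_bind [where N = lborel]) auto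
qed

context
  fixes a \<gamma> :: real and L :: nat
  assumes a: "0 < a" and g: "0 < \<gamma>" and L: "1 \<le> L"
begin

lemma integral_shrinkage_weight_pos: "0 < (\<integral>u. shrinkage_weight a 0 \<gamma> L u \<partial>lborel)"
  by (intro integral_pos_of_pos_on_positive_reals integrable_shrinkage_weight
      shrinkage_weight_nonneg shrinkage_weight_pos a g L)

lemma integral_marginal_integrand_pos:
  assumes "0 \<le> q" "0 \<le> s"
  shows "0 < (\<integral>u. marginal_integrand a \<gamma> L q s u \<partial>lborel)"
proof (rule integral_pos_of_pos_on_positive_reals)
  fix u :: real assume "0 < u"
  then show "0 < marginal_integrand a \<gamma> L q s u"
    by (simp add: marginal_integrand_def shrinkage_weight_pos)
qed (use assms a g L in \<open>auto intro: integrable_marginal_integrand marginal_integrand_nonneg\<close>)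

lemma prior_u_eq:
  "prior_u a 0 \<gamma> L = density lborel (\<lambda>u. ennreal (shrinkage_weight a 0 \<gamma> L u
      / (\<integral>u. shrinkage_weight a 0 \<gamma> L u \<partial>lborel)))"
proof -
  have "(\<integral>\<^sup>+ u. ennreal (shrinkage_weight a 0 \<gamma> L u) \<partial>lborel)
      = ennreal (\<integral>u. shrinkage_weight a 0 \<gamma> L u \<partial>lborel)"
    using integrable_shrinkage_weight [OF a g L]
    by (intro nn_integral_eq_integral) (auto simp: shrinkage_weight_nonneg)
  then show ?thesis
    using integral_shrinkage_weight_pos
    by (simp add: prior_u_def normalized_density_def divide_ennreal shrinkage_weight_nonneg)
qed

text \<open>Turns an integral over the mixture into one over \<open>u\<close>, where
  \<open>\<phi> u\<close> is the mean of \<open>h\<close> under \<open>N(0, u)\<close>. Assumptions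
  on \<open>\<phi>\<close> at positive \<open>u\<close> suffice because the weight vanishes
  elsewhere. The posterior normaliser and the unnormalised second moment are both instances.\<close>

lemma nn_integral_prior_theta:
  fixes h \<phi> :: "real \<Rightarrow> real"
  assumes [measurable]: "h \<in> borel_measurable borel"
    and h: "\<And>\<theta>. 0 \<le> h \<theta>"
    and \<phi>: "\<And>u. 0 < u \<Longrightarrow> has_bochner_integral lborel (\<lambda>\<theta>. normal_density 0 (sqrt u) \<theta> * h \<theta>) (\<phi> u)"
    and int: "integrable lborel (\<lambda>u. shrinkage_weight a 0 \<gamma> L u * \<phi> u)"
  shows "(\<integral>\<^sup>+ \<theta>. ennreal (h \<theta>) \<partial>prior_theta a 0 \<gamma> L)
    = ennreal ((\<integral>u. shrinkage_weight a 0 \<gamma> L u * \<phi> u \<partial>lborel) / (\<integral>u. shrinkage_weight a 0 \<gamma> L u \<partial>lborel))"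
proof -
  let ?w = "shrinkage_weight a 0 \<gamma> L"
  let ?C = "\<integral>u. ?w u \<partial>lborel"
  let ?N = "\<lambda>u. \<integral>\<^sup>+ \<theta>. ennreal (normal_density 0 (sqrt u) \<theta>) * ennreal (h \<theta>) \<partial>lborel"
  note C = integral_shrinkage_weight_pos
  have [measurable]: "(\<lambda>(u, \<theta>). ennreal (normal_density 0 (sqrt u) \<theta>)) \<in> borel_measurable (borel \<Otimes>\<^sub>M lborel)"
    unfolding normal_density_def by measurable
  have N: "?N u = ennreal (\<phi> u)" if "0 < u" for u
    using \<phi> [OF that] h
    by (simp add: ennreal_mult [symmetric] has_bochner_integral_iff nn_integral_eq_integral)
  have \<phi>_nonneg: "0 \<le> \<phi> u" if "0 < u" for u
    using h unfolding has_bochner_integral_integral_eq [OF \<phi> [OF that], symmetric]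
    by (intro integral_nonneg_AE) simp
  have w\<phi>: "0 \<le> ?w u * \<phi> u" for u
    by (cases "0 < u") (simp_all add: \<phi>_nonneg shrinkage_weight_nonneg, simp add: shrinkage_weight_eq)
  have "(\<integral>\<^sup>+ \<theta>. ennreal (h \<theta>) \<partial>prior_theta a 0 \<gamma> L)
      = (\<integral>\<^sup>+ u. \<integral>\<^sup>+ \<theta>. ennreal (h \<theta>) \<partial>density lborel (\<lambda>\<theta>. ennreal (normal_density 0 (sqrt u) \<theta>)) \<partial>prior_u a 0 \<gamma> L)"
    unfolding prior_theta_def by (rule nn_integral_bind [where B = lborel]) measurable
  also have "\<dots> = (\<integral>\<^sup>+ u. ?N u \<partial>prior_u a 0 \<gamma> L)"
    by (simp add: nn_integral_density)
  also have "\<dots> = (\<integral>\<^sup>+ u. ennreal (?w u / ?C) * ?N u \<partial>lborel)"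
    unfolding prior_u_eq by (rule nn_integral_density) measurable
  also have "\<dots> = (\<integral>\<^sup>+ u. ennreal (?w u * \<phi> u / ?C) \<partial>lborel)"
  proof (rule nn_integral_cong)
    fix u :: real
    show "ennreal (?w u / ?C) * ?N u = ennreal (?w u * \<phi> u / ?C)"
    proof (cases "0 < u")
      case True
      then show ?thesis
        using C \<phi>_nonneg [OF True] shrinkage_weight_nonneg [of a \<gamma> L u]
        by (simp add: N ennreal_mult [symmetric])
    qed (simp add: shrinkage_weight_eq)
  qed
  also have "\<dots> = ennreal (\<integral>u. ?w u * \<phi> u / ?C \<partial>lborel)"
    using int w\<phi> C by (intro nn_integral_eq_integral) auto
  also have "\<dots> = ennreal ((\<integral>u. ?w u * \<phi> u \<partial>lborel) / ?C)"
    by simp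
  finally show ?thesis .
qed

lemma normal_density_sqrt:
  assumes "0 < u"
  shows "normal_density 0 (sqrt (1 + u)) y
    = 1 / sqrt (2 * pi) * ((1 + u) powr - (1 / 2) * exp (- (y\<^sup>2 / 2) / (1 + u)))"
proof -
  have "sqrt (2 * pi * (sqrt (1 + u))\<^sup>2) = sqrt (2 * pi) * sqrt (1 + u)"
    using assms by (simp add: real_sqrt_mult)
  moreover have "(1 + u) powr - (1 / 2) = 1 / sqrt (1 + u)"
    using assms by (simp add: powr_minus_divide powr_half_sqrt)
  ultimately show ?thesis
    unfolding normal_density_def using assms by (simp only:) simp
qed

text \<open>Given \<open>u\<close>, the posterior mean of \<open>(\<theta> - y)\<^sup>2\<close> is
  \<open>u / (1 + u) + (y / (1 + u))\<^sup>2\<close>, that is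
  \<open>1 - 1 / (1 + u) + y\<^sup>2 / (1 + u)\<^sup>2\<close>. Each factor
  \<open>1 / (1 + u)\<close> raises \<open>q\<close> by 1, and the constants \<open>?k\<close> and
  \<open>?C\<close> cancel in the quotient.\<close>

lemma MSE_eq:
  fixes y :: real
  defines "I \<equiv> \<lambda>q. \<integral>u. marginal_integrand a \<gamma> L q (y\<^sup>2 / 2) u \<partial>lborel"
  shows "MSE a 0 \<gamma> L y = 1 - I (3 / 2) / I (1 / 2) + y\<^sup>2 * (I (5 / 2) / I (1 / 2))"
proof -
  let ?w = "shrinkage_weight a 0 \<gamma> L" and ?k = "1 / sqrt (2 * pi)" and ?P = "prior_theta a 0 \<gamma> L"
  let ?m = "\<lambda>q. marginal_integrand a \<gamma> L q (y\<^sup>2 / 2)"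
  let ?C = "\<integral>u. ?w u \<partial>lborel"
  let ?\<phi> = "\<lambda>u. normal_density 0 (sqrt (1 + u)) y"
  let ?\<psi> = "\<lambda>u. ?\<phi> u * (1 - 1 / (1 + u) + y\<^sup>2 / (1 + u)\<^sup>2)"
  note C = integral_shrinkage_weight_pos
  have int: "integrable lborel (?m q)" if "0 \<le> q" for q
    using that by (intro integrable_marginal_integrand a g L) auto
  have [measurable]: "(\<lambda>\<theta>. normal_density \<theta> 1 y) \<in> borel_measurable borel"
    unfolding normal_density_def by measurable
  have w\<phi>: "?w u * ?\<phi> u = ?k * ?m (1 / 2) u" for u
    by (cases "0 < u") (auto simp: normal_density_sqrt marginal_integrand_def shrinkage_weight_eq)
  have w\<psi>: "?w u * ?\<psi> u = ?k * (?m (1 / 2) u - ?m (3 / 2) u + y\<^sup>2 * ?m (5 / 2) u)" for u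
  proof (cases "0 < u")
    case True
    have "(1 + u) powr - (3 / 2) = (1 + u) powr - (1 / 2) / (1 + u)"
      using True powr_diff [of "1 + u" "- (1 / 2)" 1] by simp
    moreover have "(1 + u) powr - (5 / 2) = (1 + u) powr - (1 / 2) / (1 + u)\<^sup>2"
      using True powr_diff [of "1 + u" "- (1 / 2)" 2] by simp
    ultimately have "?m (3 / 2) u = ?m (1 / 2) u / (1 + u)" "?m (5 / 2) u = ?m (1 / 2) u / (1 + u)\<^sup>2"
      by (auto simp: marginal_integrand_def)
    moreover have "k * (m - m / t + Y * (m / t\<^sup>2)) = k * m * (1 - 1 / t + Y / t\<^sup>2)" for k m t Y :: real
      by (simp add: algebra_simps)
    ultimately have "?k * (?m (1 / 2) u - ?m (3 / 2) u + y\<^sup>2 * ?m (5 / 2) u)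
        = ?k * ?m (1 / 2) u * (1 - 1 / (1 + u) + y\<^sup>2 / (1 + u)\<^sup>2)"
      by (simp only:)
    also have "\<dots> = ?w u * ?\<phi> u * (1 - 1 / (1 + u) + y\<^sup>2 / (1 + u)\<^sup>2)"
      unfolding w\<phi> ..
    finally show ?thesis
      by (simp only: mult.assoc)
  qed (simp add: shrinkage_weight_eq marginal_integrand_nonpos_arg)
  \<comment> \<open>The evidence: the denominator in Bayes' rule.\<close>
  have Z: "(\<integral>\<^sup>+ \<theta>. ennreal (normal_density \<theta> 1 y) \<partial>?P) = ennreal (?k * I (1 / 2) / ?C)"
  proof -
    have "(\<integral>\<^sup>+ \<theta>. ennreal (normal_density \<theta> 1 y) \<partial>?P) = ennreal ((\<integral>u. ?w u * ?\<phi> u \<partial>lborel) / ?C)"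
    proof (rule nn_integral_prior_theta)
      fix u :: real assume u: "0 < u"
      have "has_bochner_integral lborel
          (\<lambda>\<theta>. ?\<phi> u * normal_density (u * y / (1 + u)) (sqrt (u / (1 + u))) \<theta>) (?\<phi> u * 1)"
        using u normal_moment_even [of "sqrt (u / (1 + u))" _ 0]
        by (intro has_bochner_integral_mult_right) simp
      then show "has_bochner_integral lborel (\<lambda>\<theta>. normal_density 0 (sqrt u) \<theta> * normal_density \<theta> 1 y) (?\<phi> u)"
        using normal_density_product [OF u] by (simp add: mult.commute)
    qed (auto simp: w\<phi> int)
    then show ?thesis by (simp add: w\<phi> I_def)
  qed
  have J: "(\<integral>u. ?w u * ?\<psi> u \<partial>lborel) = ?k * (I (1 / 2) - I (3 / 2) + y\<^sup>2 * I (5 / 2))"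
    unfolding w\<psi> I_def using int by simp
  \<comment> \<open>The sign of the combination of \<open>I\<close> values is read off from its
    integral form, as it contains a subtraction. It is required below to cancel
    \<open>enn2real\<close> against \<open>ennreal\<close>.\<close>
  have "0 \<le> ?w u * ?\<psi> u" for u
  proof (cases "0 < u")
    case True
    then show ?thesis
      by (intro mult_nonneg_nonneg add_nonneg_nonneg shrinkage_weight_nonneg) auto
  qed (simp add: shrinkage_weight_eq)
  then have J_nonneg: "0 \<le> ?k * (I (1 / 2) - I (3 / 2) + y\<^sup>2 * I (5 / 2))"
    unfolding J [symmetric] by (intro integral_nonneg_AE) simp
  have N: "(\<integral>\<^sup>+ \<theta>. ennreal (normal_density \<theta> 1 y * (\<theta> - y)\<^sup>2) \<partial>?P)
      = ennreal (?k * (I (1 / 2) - I (3 / 2) + y\<^sup>2 * I (5 / 2)) / ?C)"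
  proof -
    have "(\<integral>\<^sup>+ \<theta>. ennreal (normal_density \<theta> 1 y * (\<theta> - y)\<^sup>2) \<partial>?P) = ennreal ((\<integral>u. ?w u * ?\<psi> u \<partial>lborel) / ?C)"
    proof (rule nn_integral_prior_theta)
      fix u :: real assume u: "0 < u"
      have "(sqrt (u / (1 + u)))\<^sup>2 + (u * y / (1 + u) - y)\<^sup>2 = 1 - 1 / (1 + u) + y\<^sup>2 / (1 + u)\<^sup>2"
      proof -
        have "u * y / (1 + u) - y = - y / (1 + u)"
          using u by (simp add: field_simps)
        then have "(u * y / (1 + u) - y)\<^sup>2 = y\<^sup>2 / (1 + u)\<^sup>2"
          by (simp add: power_divide)
        moreover have "(sqrt (u / (1 + u)))\<^sup>2 = 1 - 1 / (1 + u)"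
          using u by (simp add: field_simps)
        ultimately show ?thesis by simp
      qed
      moreover have "has_bochner_integral lborel
          (\<lambda>\<theta>. ?\<phi> u * (normal_density (u * y / (1 + u)) (sqrt (u / (1 + u))) \<theta> * (\<theta> - y)\<^sup>2))
          (?\<phi> u * ((sqrt (u / (1 + u)))\<^sup>2 + (u * y / (1 + u) - y)\<^sup>2))"
        using u by (intro has_bochner_integral_mult_right normal_second_moment) simp
      moreover have "normal_density 0 (sqrt u) \<theta> * (normal_density \<theta> 1 y * (\<theta> - y)\<^sup>2)
          = ?\<phi> u * (normal_density (u * y / (1 + u)) (sqrt (u / (1 + u))) \<theta> * (\<theta> - y)\<^sup>2)" for \<theta>
        using normal_density_product [OF u, of \<theta> y] by (simp add: mult_ac)
      ultimately show "has_bochner_integral lborel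
          (\<lambda>\<theta>. normal_density 0 (sqrt u) \<theta> * (normal_density \<theta> 1 y * (\<theta> - y)\<^sup>2)) (?\<psi> u)"
        by (simp only:)
    next
      show "integrable lborel (\<lambda>u. ?w u * ?\<psi> u)"
        unfolding w\<psi> using int by auto
    qed auto
    then show ?thesis unfolding J .
  qed
  have I: "0 < I (1 / 2)"
    unfolding I_def by (rule integral_marginal_integrand_pos) auto
  have [measurable]: "(\<lambda>\<theta>. (\<theta> - y)\<^sup>2) \<in> borel_measurable ?P"
    by measurable
  let ?z = "?k * I (1 / 2) / ?C"
  have z: "0 < ?z"
    using I C by simp
  have "posterior a 0 \<gamma> L y = density ?P (\<lambda>\<theta>. ennreal (normal_density \<theta> 1 y / ?z))"
    using z by (simp add: posterior_def normalized_density_def Z divide_ennreal)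
  then have "MSE a 0 \<gamma> L y = (\<integral>\<theta>. (\<theta> - y)\<^sup>2 \<partial>density ?P (\<lambda>\<theta>. ennreal (normal_density \<theta> 1 y / ?z)))"
    unfolding MSE_def by (simp only:)
  also have "\<dots> = (\<integral>\<theta>. normal_density \<theta> 1 y / ?z * (\<theta> - y)\<^sup>2 \<partial>?P)"
  proof (rule integral_real_density)
    show "AE \<theta> in ?P. 0 \<le> normal_density \<theta> 1 y / ?z"
      using z by (intro AE_I2 divide_nonneg_pos normal_density_nonneg)
  qed measurable
  \<comment> \<open>The integrand is nonnegative, so the expectation can be computed in the extended
    reals. There \<open>N\<close> shows it to be finite, so the value is not the default 0 of a
    divergent integral.\<close>
  also have "\<dots> = enn2real (\<integral>\<^sup>+ \<theta>. ennreal (normal_density \<theta> 1 y / ?z * (\<theta> - y)\<^sup>2) \<partial>?P)"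
    using z by (intro integral_eq_nn_integral AE_I2 mult_nonneg_nonneg divide_nonneg_pos) auto
  also have "(\<integral>\<^sup>+ \<theta>. ennreal (normal_density \<theta> 1 y / ?z * (\<theta> - y)\<^sup>2) \<partial>?P)
      = (\<integral>\<^sup>+ \<theta>. ennreal (1 / ?z) * ennreal (normal_density \<theta> 1 y * (\<theta> - y)\<^sup>2) \<partial>?P)"
  proof (rule nn_integral_cong)
    fix \<theta> :: real
    have split: "ennreal (p / z * x) = ennreal (1 / z) * ennreal (p * x)" if "0 < z" "0 \<le> p * x" for p x z :: real
      using that by (simp add: ennreal_mult [symmetric])
    show "ennreal (normal_density \<theta> 1 y / ?z * (\<theta> - y)\<^sup>2)
        = ennreal (1 / ?z) * ennreal (normal_density \<theta> 1 y * (\<theta> - y)\<^sup>2)"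
      by (rule split [OF z]) simp
  qed
  also have "\<dots> = ennreal (1 / ?z) * (\<integral>\<^sup>+ \<theta>. ennreal (normal_density \<theta> 1 y * (\<theta> - y)\<^sup>2) \<partial>?P)"
    by (intro nn_integral_cmult) measurable
  also have "\<dots> = ennreal (1 / ?z * (?k * (I (1 / 2) - I (3 / 2) + y\<^sup>2 * I (5 / 2)) / ?C))"
    unfolding N by (intro ennreal_mult' [symmetric] divide_nonneg_pos zero_le_one z)
  finally have "MSE a 0 \<gamma> L y = 1 / ?z * (?k * (I (1 / 2) - I (3 / 2) + y\<^sup>2 * I (5 / 2)) / ?C)"
    by (simp only: enn2real_ennreal mult_nonneg_nonneg J_nonneg
        divide_nonneg_pos [OF J_nonneg C] divide_nonneg_pos [OF zero_le_one z])
  also have "\<dots> = 1 - I (3 / 2) / I (1 / 2) + y\<^sup>2 * (I (5 / 2) / I (1 / 2))"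
    using C I by (simp add: field_simps)
  finally show ?thesis .
qed

text \<open>With \<open>s = y\<^sup>2 / 2\<close>, the ratio \<open>I(5/2) / I(1/2)\<close>
  telescopes through \<open>I(3/2)\<close>, so the expression is a polynomial in the two ratios
  \<open>?r (1 / 2)\<close> and \<open>?r (3 / 2)\<close>, whose limits are 1/2 and 3/2.\<close>

lemma MSE_minus_1_tendsto:
  "((\<lambda>y. y\<^sup>2 / 2 * (MSE a 0 \<gamma> L y - 1)) \<longlongrightarrow> 1) at_infinity"
proof -
  let ?I = "\<lambda>q s. \<integral>u. marginal_integrand a \<gamma> L q s u \<partial>lborel"
  let ?r = "\<lambda>q s. s * (?I (q + 1) s / ?I q s)"
  have at_top: "filterlim (\<lambda>y::real. y\<^sup>2 / 2) at_top at_infinity"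
    unfolding at_infinity_eq_at_top_bot by (intro filterlim_sup) real_asymp+
  have "((\<lambda>s. - ?r (1 / 2) s + 2 * (?r (3 / 2) s * ?r (1 / 2) s)) \<longlongrightarrow> - (1 / 2) + 2 * (3 / 2 * (1 / 2))) at_top"
    by (intro tendsto_intros marginal_ratio_tendsto a g L) auto
  then have "((\<lambda>y. - ?r (1 / 2) (y\<^sup>2 / 2) + 2 * (?r (3 / 2) (y\<^sup>2 / 2) * ?r (1 / 2) (y\<^sup>2 / 2))) \<longlongrightarrow> 1) at_infinity"
    using filterlim_compose [OF _ at_top] by fastforce
  moreover have "- ?r (1 / 2) (y\<^sup>2 / 2) + 2 * (?r (3 / 2) (y\<^sup>2 / 2) * ?r (1 / 2) (y\<^sup>2 / 2))
      = y\<^sup>2 / 2 * (MSE a 0 \<gamma> L y - 1)" for y :: real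
  proof -
    have "0 < ?I (1 / 2) (y\<^sup>2 / 2)" "0 < ?I (3 / 2) (y\<^sup>2 / 2)"
      by (auto intro!: integral_marginal_integrand_pos)
    then show ?thesis
      by (simp add: MSE_eq field_simps)
  qed
  ultimately show ?thesis by (simp only:)
qed

end

section \<open>The bracket of the expansion and the conclusion\<close>

text \<open>Every product in the bracket is nonempty, the last one because \<open>1 \<le> L\<close>,
  and each of its factors tends to 0; the sum is finite.\<close>

lemma expansion_factor_tendsto:
  "((\<lambda>y::real. 1 - (3 * a / 2) / (y\<^sup>2 / 2)
      + (\<Sum>k\<in>{1..<L}. \<Prod>j\<in>{1..k}. 1 / iter_log j (1 + y\<^sup>2 / 2))
      + (1 + \<gamma>) * (\<Prod>j\<in>{1..L}. 1 / iter_log j (1 + y\<^sup>2 / 2))) \<longlongrightarrow> 1) at_infinity"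
  if "1 \<le> L"
proof -
  have at_top: "filterlim (\<lambda>y::real. y\<^sup>2 / 2) at_top at_infinity"
    unfolding at_infinity_eq_at_top_bot by (intro filterlim_sup) real_asymp+
  have at_top': "filterlim (\<lambda>y::real. 1 + y\<^sup>2 / 2) at_top at_infinity"
    by (intro filterlim_tendsto_add_at_top [OF tendsto_const] at_top)
  have inv: "((\<lambda>y::real. 1 / iter_log j (1 + y\<^sup>2 / 2)) \<longlongrightarrow> 0) at_infinity" for j
    by (intro tendsto_divide_0 [OF tendsto_const] filterlim_at_top_imp_at_infinity
        filterlim_compose [OF iter_log_at_top at_top'])
  have prod: "((\<lambda>y::real. \<Prod>j\<in>{1..k}. 1 / iter_log j (1 + y\<^sup>2 / 2)) \<longlongrightarrow> 0) at_infinity" if "1 \<le> k" for k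
  proof -
    have "((\<lambda>y::real. \<Prod>j\<in>{1..k}. 1 / iter_log j (1 + y\<^sup>2 / 2)) \<longlongrightarrow> (\<Prod>j\<in>{1..k}. 0)) at_infinity"
      by (intro tendsto_prod inv)
    then show ?thesis using that by (simp add: power_0_left)
  qed
  have "((\<lambda>y::real. 1 - (3 * a / 2) / (y\<^sup>2 / 2)
      + (\<Sum>k\<in>{1..<L}. \<Prod>j\<in>{1..k}. 1 / iter_log j (1 + y\<^sup>2 / 2))
      + (1 + \<gamma>) * (\<Prod>j\<in>{1..L}. 1 / iter_log j (1 + y\<^sup>2 / 2)))
      \<longlongrightarrow> 1 - 0 + (\<Sum>k\<in>{1..<L}. 0) + (1 + \<gamma>) * 0) at_infinity"
    by (intro tendsto_intros prod tendsto_divide_0 [OF tendsto_const] filterlim_at_top_imp_at_infinity at_top)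
       (use that in auto)
  then show ?thesis by simp
qed

theorem theorem4:
  fixes a b \<gamma> :: real and L :: nat
  assumes "a > 0" and "b = 0" and "\<gamma> > 0" and "L \<ge> 1"
  shows "(\<lambda>y::real. MSE a b \<gamma> L y -
           (1 + 1 / (y\<^sup>2 / 2) *
             (1 - (3 * a / 2) / (y\<^sup>2 / 2)
              + (\<Sum>k\<in>{1..<L}. \<Prod>j\<in>{1..k}. 1 / iter_log j (1 + y\<^sup>2 / 2))
              + (1 + \<gamma>) * (\<Prod>j\<in>{1..L}. 1 / iter_log j (1 + y\<^sup>2 / 2)))))
         \<in> o[at_infinity](\<lambda>y. 1 / y\<^sup>2)"
proof (rule smalloI_tendsto)
  let ?B = "\<lambda>y::real. 1 - (3 * a / 2) / (y\<^sup>2 / 2)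
      + (\<Sum>k\<in>{1..<L}. \<Prod>j\<in>{1..k}. 1 / iter_log j (1 + y\<^sup>2 / 2))
      + (1 + \<gamma>) * (\<Prod>j\<in>{1..L}. 1 / iter_log j (1 + y\<^sup>2 / 2))"
  have nz: "\<forall>\<^sub>F y::real in at_infinity. y \<noteq> 0"
    by (rule eventually_not_equal_at_infinity)
  then show "\<forall>\<^sub>F y::real in at_infinity. 1 / y\<^sup>2 \<noteq> 0"
    by eventually_elim simp
  \<comment> \<open>Dividing the error by \<open>1 / y\<^sup>2\<close> gives twice the difference of
    two quantities that both tend to 1.\<close>
  have "((\<lambda>y. 2 * (y\<^sup>2 / 2 * (MSE a 0 \<gamma> L y - 1) - ?B y)) \<longlongrightarrow> 2 * (1 - 1)) at_infinity"
    using assms by (intro tendsto_mult tendsto_const tendsto_diff MSE_minus_1_tendsto expansion_factor_tendsto) auto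
  moreover have "\<forall>\<^sub>F y in at_infinity. 2 * (y\<^sup>2 / 2 * (MSE a 0 \<gamma> L y - 1) - ?B y)
      = (MSE a b \<gamma> L y - (1 + 1 / (y\<^sup>2 / 2) * ?B y)) / (1 / y\<^sup>2)"
    using nz
  proof eventually_elim
    case (elim y)
    have "2 * (y\<^sup>2 / 2 * (m - 1) - B) = (m - (1 + 1 / (y\<^sup>2 / 2) * B)) / (1 / y\<^sup>2)" for m B
      using elim by (simp add: field_simps)
    then show ?case unfolding \<open>b = 0\<close> .
  qed
  ultimately show "((\<lambda>y. (MSE a b \<gamma> L y - (1 + 1 / (y\<^sup>2 / 2) * ?B y)) / (1 / y\<^sup>2)) \<longlongrightarrow> 0) at_infinity"
    using Lim_transform_eventually by fastforce
qed

end
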